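(* For each positive integer $n$, let $f(n)$ be the maximum of $a_1+\cdots+a_n$ over all packings of $n$ non-overlapping equilateral triangles, with side lengths $a_1,\ldots,a_n$, inside an equilateral triangle of side length $1$. For each positive integer $k$ let $\epsilon(k):=f(k^2+1)-k$. Then $f(k^2+1)=k$ for all positive integers $k$ if and only if the series $\sum_{k\geqslant 1}\epsilon(k)$ converges.
   Context: A packing of $n$ non-overlapping equilateral triangles inside the unit equilateral triangle means $n$ equilateral triangles contained in the (closed) unit equilateral triangle with pairwise disjoint interiors. The small triangles may have different sizes and arbitrary positions and orientations. *)

theory Defs
  imports "HOL-Analysis.Analysis"
begin

text \<open>The type \<^typ>\<open>complex\<close> serves as the Euclidean plane. Triangles are closed and solid.\<close>

definition equilateral_triangle :: "real \<Rightarrow> complex set \<Rightarrow> bool" where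
  "equilateral_triangle s T \<longleftrightarrow> s > 0 \<and>
     (\<exists>A B C. dist A B = s \<and> dist B C = s \<and> dist C A = s \<and> T = convex hull {A, B, C})"

text \<open>Unit equilateral triangles are all congruent, so one of them is fixed as the container.\<close>

definition unit_triangle :: "complex set" where
  "unit_triangle = convex hull {0, 1, cis (pi / 3)}"

definition triangle_packing :: "nat \<Rightarrow> (nat \<Rightarrow> real) \<Rightarrow> (nat \<Rightarrow> complex set) \<Rightarrow> bool" where
  "triangle_packing n a T \<longleftrightarrow>
     (\<forall>i<n. equilateral_triangle (a i) (T i) \<and> T i \<subseteq> unit_triangle) \<and>
     disjoint_family_on (\<lambda>i. interior (T i)) {..<n}"

text \<open>
  The operator \<open>GREATEST\<close> denotes an attained maximum, not a supremum. For \<open>n \<ge> 1\<close> it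
  exists although side lengths are required to be positive: a limit of packings
  may contain triangles of side 0, but cutting two triangles of side \<open>s / 2\<close> out of one of
  side \<open>s\<close> makes up the number of triangles without changing the sum.
\<close>

definition max_side_sum :: "nat \<Rightarrow> real" where
  "max_side_sum n = (GREATEST s. \<exists>a T. triangle_packing n a T \<and> s = (\<Sum>i<n. a i))"

definition excess :: "nat \<Rightarrow> real" where
  "excess k = max_side_sum (k\<^sup>2 + 1) - real k"

end

theory Submission
  imports Defs
begin

text \<open>
  Only the implication from convergence to vanishing needs an argument, and it rests on one
  construction. Subdivide the triangle of side \<open>m\<close> into \<open>m\<^sup>2\<close> unit cells and
  let \<open>1 \<le> k \<le> m\<close>. The corner triangle of side \<open>k\<close> consists of
  \<open>k\<^sup>2\<close> of these cells; replace them by an optimal packing of \<open>k\<^sup>2 + 1\<close>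
  triangles, enlarged by the factor \<open>k\<close>. The result is a packing of
  \<open>m\<^sup>2 + 1\<close> triangles with side sum
  \<open>(m\<^sup>2 - k\<^sup>2) + k * (k + excess k)\<close>. Shrinking it to the unit triangle
  gives \<open>excess m \<ge> k * excess k / m\<close>, so \<open>k * excess k\<close> is nondecreasing
  in \<open>k\<close> (lemma \<open>excess_mult_mono\<close>).
  
  The excess is nonnegative: two halves of the unit triangle show it for \<open>k = 1\<close>, and
  monotonicity carries it to all \<open>k\<close>. A single positive value
  \<open>excess k\<close> would therefore bound the excess from below, from \<open>k\<close> on, by a positive
  multiple of the terms of the harmonic series.
  
  All of this presupposes that the maximum is attained (lemma
  \<open>optimal_packing_exists\<close>). Families of \<open>n\<close> possibly degenerate triangles
  form a compact space, because the interior of a triangle depends on its vertices through strict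
  polynomial inequalities, which makes disjointness of interiors a closed condition. A maximising
  family is made nondegenerate by discarding its points and replacing triangles by two of half the
  side, which keeps the side sum, until the number is right again.
\<close>

section \<open>Equilateral triangles in oblique coordinates\<close>

text \<open>
  A triangle is given by a vertex \<open>A\<close> and the edge vector \<open>d\<close> to the next
  vertex in counterclockwise order. The value \<open>d = 0\<close> is admitted so that the parameters
  form a closed set.
\<close>

definition tri :: "complex \<Rightarrow> complex \<Rightarrow> complex set" where
  "tri A d = convex hull {A, A + d, A + d * cis (pi / 3)}"

text \<open>
  The real coordinates of \<open>z = x + y * cis (pi / 3)\<close>: in them the triangular grid is
  the integer grid, and the sides of its cells lie on lines where \<open>x\<close>, \<open>y\<close> or
  \<open>x + y\<close> is constant.
\<close>

definition skew_x :: "complex \<Rightarrow> real" where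
  "skew_x z = Re z - Im z / sqrt 3"

definition skew_y :: "complex \<Rightarrow> real" where
  "skew_y z = 2 * Im z / sqrt 3"

lemma cis_pi_third: "cis (pi / 3) = Complex (1/2) (sqrt 3 / 2)"
  by (simp add: complex_eq_iff cos_60 sin_60)

lemma skew_eqI: "skew_x z = skew_x w \<Longrightarrow> skew_y z = skew_y w \<Longrightarrow> z = w"
  by (simp add: skew_x_def skew_y_def complex_eq_iff)

lemma skew_basis [simp]:
  "skew_x 0 = 0" "skew_y 0 = 0" "skew_x 1 = 1" "skew_y 1 = 0"
  "skew_x (cis (pi / 3)) = 0" "skew_y (cis (pi / 3)) = 1"
  by (simp_all add: skew_x_def skew_y_def cis_pi_third)

lemma skew_linear [simp]:
  "skew_x (z + w) = skew_x z + skew_x w" "skew_y (z + w) = skew_y z + skew_y w"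
  "skew_x (z - w) = skew_x z - skew_x w" "skew_y (z - w) = skew_y z - skew_y w"
  "skew_x (- z) = - skew_x z" "skew_y (- z) = - skew_y z"
  "skew_x (of_real r * z) = r * skew_x z" "skew_y (of_real r * z) = r * skew_y z"
  "skew_x (r *\<^sub>R z) = r * skew_x z" "skew_y (r *\<^sub>R z) = r * skew_y z"
  "skew_x (z / of_real r) = skew_x z / r" "skew_y (z / of_real r) = skew_y z / r"
  by (simp_all add: skew_x_def skew_y_def algebra_simps add_divide_distrib diff_divide_distrib)

lemma skew_of_real [simp]: 
  "skew_x (of_real r) = r" "skew_y (of_real r) = 0"
  "skew_x (of_nat n) = of_nat n" "skew_y (of_nat n) = 0"
  by (simp_all add: skew_x_def skew_y_def)

lemma continuous_on_skew [continuous_intros]: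
  assumes "continuous_on S f"
  shows "continuous_on S (\<lambda>x. skew_x (f x))" "continuous_on S (\<lambda>x. skew_y (f x))"
  unfolding skew_x_def skew_y_def by (intro continuous_intros assms; simp)+

lemma tri_degenerate [simp]: "tri A 0 = {A}"
  by (simp add: tri_def)

lemma tri_affine: "(\<lambda>z. c + e * z) ` tri A d = tri (c + e * A) (e * d)"
proof -
  have "(\<lambda>z. c + e * z) ` tri A d = (+) c ` (*) e ` tri A d"
    by (simp add: image_image)
  also have "\<dots> = (+) c ` (convex hull (*) e ` {A, A + d, A + d * cis (pi / 3)})"
    unfolding tri_def by (simp only: convex_hull_linear_image linear_times)
  also have "\<dots> = convex hull (+) c ` (*) e ` {A, A + d, A + d * cis (pi / 3)}"
    by (simp only: convex_hull_translation)
  also have "\<dots> = tri (c + e * A) (e * d)"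
    by (simp add: tri_def distrib_left mult.assoc add.assoc)
  finally show ?thesis .
qed

lemma mem_tri_unit: "z \<in> tri 0 1 \<longleftrightarrow> 0 \<le> skew_x z \<and> 0 \<le> skew_y z \<and> skew_x z + skew_y z \<le> 1"
  (is "_ \<longleftrightarrow> ?R")
proof
  assume "z \<in> tri 0 1"
  then show ?R by (auto simp: tri_def convex_hull_3_alt)
next
  assume ?R
  moreover have "z = skew_x z *\<^sub>R 1 + skew_y z *\<^sub>R cis (pi / 3)"
    by (rule skew_eqI) (simp_all del: scaleR_conv_of_real)
  ultimately show "z \<in> tri 0 1"
    unfolding tri_def convex_hull_3_alt
    by (simp del: scaleR_conv_of_real) blast
qed

lemma interior_tri_unit:
  "z \<in> interior (tri 0 1) \<longleftrightarrow> 0 < skew_x z \<and> 0 < skew_y z \<and> skew_x z + skew_y z < 1"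
  (is "_ \<longleftrightarrow> ?R")
proof -
  have "\<not> collinear {0, 1, cis (pi / 3)}"
    by (auto simp: collinear_lemma cis_pi_third complex_eq_iff)
  then have eq: "interior (tri 0 1) =
      {v. \<exists>x y w. 0 < x \<and> 0 < y \<and> 0 < w \<and> x + y + w = 1 \<and>
        x *\<^sub>R 0 + y *\<^sub>R 1 + w *\<^sub>R cis (pi / 3) = v}"
    unfolding tri_def using interior_convex_hull_3_minimal [of 0 1 "cis (pi / 3)"] by simp
  show ?thesis
  proof
    assume "z \<in> interior (tri 0 1)"
    then show ?R by (auto simp: eq simp del: scaleR_conv_of_real)
  next
    assume R: ?R
    have "z = skew_x z *\<^sub>R 1 + skew_y z *\<^sub>R cis (pi / 3)"
      by (rule skew_eqI) (simp_all del: scaleR_conv_of_real)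
    then have "(1 - skew_x z - skew_y z) *\<^sub>R 0 + skew_x z *\<^sub>R 1 + skew_y z *\<^sub>R cis (pi / 3) = z"
      by simp
    then show "z \<in> interior (tri 0 1)" 
      unfolding eq mem_Collect_eq
      using R by (intro exI [of _ "1 - skew_x z - skew_y z"] exI [of _ "skew_x z"] exI [of _ "skew_y z"]) auto
  qed
qed

lemma interior_affine_image:
  assumes "e \<noteq> 0"
  shows "interior ((\<lambda>z. c + e * z) ` S) = (\<lambda>z. c + e * z) ` interior (S :: complex set)"
proof -
  have "interior ((\<lambda>z. c + e * z) ` S) = interior ((+) c ` (*) e ` S)"
    by (simp add: image_image)
  also have "\<dots> = (+) c ` (*) e ` interior S"
    using assms
    by (subst interior_translation, subst interior_injective_linear_image)
       (auto simp: linear_times inj_on_def)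
  finally show ?thesis by (simp add: image_image)
qed

lemma mem_affine_image:
  assumes "d \<noteq> (0 :: complex)"
  shows "z \<in> (\<lambda>w. A + d * w) ` S \<longleftrightarrow> (z - A) / d \<in> S"
  using assms by (auto simp: image_iff intro!: bexI [of _ "(z - A) / d"])

lemma mem_tri:
  assumes "d \<noteq> 0"
  shows "z \<in> tri A d \<longleftrightarrow>
    0 \<le> skew_x ((z - A) / d) \<and> 0 \<le> skew_y ((z - A) / d) \<and>
    skew_x ((z - A) / d) + skew_y ((z - A) / d) \<le> 1"
  using tri_affine [of A d 0 1] mem_affine_image [OF assms, of z A "tri 0 1"]
  by (simp add: mem_tri_unit del: skew_linear)

lemma mem_interior_tri:
  assumes "d \<noteq> 0"
  shows "z \<in> interior (tri A d) \<longleftrightarrow>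
    0 < skew_x ((z - A) / d) \<and> 0 < skew_y ((z - A) / d) \<and>
    skew_x ((z - A) / d) + skew_y ((z - A) / d) < 1"
  using tri_affine [of A d 0 1] mem_affine_image [OF assms, of z A "interior (tri 0 1)"]
    interior_affine_image [OF assms, of A "tri 0 1"]
  by (simp add: interior_tri_unit del: skew_linear)

text \<open>
  Multiplying by the conjugate of \<open>d\<close> in place of dividing by \<open>d\<close> makes both sides
  of each inequality continuous in \<open>z\<close>, \<open>A\<close> and \<open>d\<close>. For
  \<open>d = 0\<close> the inequalities read \<open>0 < 0\<close>, in agreement with the empty interior of a
  point.
\<close>

lemma mem_interior_tri_polynomial:
  "z \<in> interior (tri A d) \<longleftrightarrow>
    0 < skew_x ((z - A) * cnj d) \<and> 0 < skew_y ((z - A) * cnj d) \<and>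
    skew_x ((z - A) * cnj d) + skew_y ((z - A) * cnj d) < (norm d)\<^sup>2"
proof (cases "d = 0")
  case False
  define w r where "w = (z - A) * cnj d" and "r = (norm d)\<^sup>2"
  have "r > 0" using False by (simp add: r_def)
  have "(z - A) / d = w / of_real r"
    unfolding w_def r_def by (rule complex_div_cnj)
  then have "skew_x ((z - A) / d) = skew_x w / r" "skew_y ((z - A) / d) = skew_y w / r"
    by (simp_all only: skew_linear)
  then show ?thesis
    unfolding mem_interior_tri [OF False] w_def [symmetric] r_def [symmetric]
    using \<open>r > 0\<close> by (simp add: add_divide_distrib [symmetric] zero_less_divide_iff)
qed (simp add: interior_singleton)

lemma interior_tri_nonempty:
  assumes "d \<noteq> 0"
  shows "interior (tri A d) \<noteq> {}"
proof -
  define z where "z = of_real (1/4) + of_real (1/4) * cis (pi / 3)"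
  have "z \<in> interior (tri 0 1)"
    unfolding interior_tri_unit z_def by (simp only: skew_linear skew_of_real skew_basis) simp
  then show ?thesis
    using tri_affine [of A d 0 1] interior_affine_image [OF assms, of A "tri 0 1"] by auto
qed

lemma tri_subset_iff:
  assumes "convex S"
  shows "tri A d \<subseteq> S \<longleftrightarrow> A \<in> S \<and> A + d \<in> S \<and> A + d * cis (pi / 3) \<in> S"
  unfolding tri_def using assms by (auto simp: subset_hull)

lemma convex_tri [simp]: "convex (tri A d)" and compact_tri [simp]: "compact (tri A d)"
  by (simp_all add: tri_def compact_convex_hull finite_imp_compact)

lemma unit_triangle_eq: "unit_triangle = tri 0 1"
  by (simp add: unit_triangle_def tri_def)

text \<open>
  The apex over the base from \<open>0\<close> to \<open>1\<close> is \<open>cis (pi / 3)\<close> or its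
  conjugate, which is its inverse. In the second case the triangle is the one that has the
  apex as its first edge vector.
\<close>

lemma equilateral_apex:
  assumes "norm w = 1" "norm (w - 1) = 1"
  shows "w = cis (pi / 3) \<or> w * cis (pi / 3) = 1"
proof -
  have 1: "(Re w)\<^sup>2 + (Im w)\<^sup>2 = 1" "(Re w - 1)\<^sup>2 + (Im w)\<^sup>2 = 1"
    using assms by (simp_all add: cmod_def)
  then have re: "Re w = 1 / 2" by (simp add: power2_eq_square algebra_simps)
  with 1 have "(Im w)\<^sup>2 = (sqrt 3 / 2)\<^sup>2" by (simp add: power2_eq_square algebra_simps)
  then have "Im w = sqrt 3 / 2 \<or> Im w = - (sqrt 3 / 2)" by (simp only: power2_eq_iff)
  with re show ?thesis
    by (auto simp: cis_pi_third complex_eq_iff)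
qed

lemma equilateral_triangle_iff_tri:
  "equilateral_triangle s T \<longleftrightarrow> (\<exists>A d. d \<noteq> 0 \<and> s = norm d \<and> T = tri A d)"
proof
  assume "equilateral_triangle s T"
  then obtain A B C where s: "s > 0" "dist A B = s" "dist B C = s" "dist C A = s"
    and T: "T = convex hull {A, B, C}"
    unfolding equilateral_triangle_def by blast
  define w where "w = (C - A) / (B - A)"
  have ne: "B - A \<noteq> 0" "C - A \<noteq> 0" using s by auto
  have "norm w = 1"
    using s by (simp add: w_def norm_divide dist_norm norm_minus_commute)
  moreover have "w - 1 = (C - B) / (B - A)" using ne by (simp add: w_def field_simps)
  then have "norm (w - 1) = 1"
    using s by (simp add: norm_divide dist_norm norm_minus_commute)
  ultimately consider "w = cis (pi / 3)" | "w * cis (pi / 3) = 1"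
    using equilateral_apex by blast
  then show "\<exists>A d. d \<noteq> 0 \<and> s = norm d \<and> T = tri A d"
  proof cases
    case 1
    then have "C = A + (B - A) * cis (pi / 3)" using ne by (simp add: w_def field_simps)
    then have "T = tri A (B - A)" by (simp add: T tri_def)
    with s ne show ?thesis by (metis dist_norm norm_minus_commute)
  next
    case 2
    then have "B = A + (C - A) * cis (pi / 3)" using ne by (simp add: w_def field_simps)
    then have "T = tri A (C - A)" by (simp add: T tri_def insert_commute)
    with s ne show ?thesis by (metis dist_norm)
  qed
next
  assume "\<exists>A d. d \<noteq> 0 \<and> s = norm d \<and> T = tri A d"
  then obtain A d where d: "d \<noteq> 0" "s = norm d" "T = tri A d" by blast
  have "d - d * cis (pi / 3) = d * (1 - cis (pi / 3))" by (simp add: algebra_simps)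
  moreover have "norm (1 - cis (pi / 3)) = 1"
    by (simp add: cis_pi_third cmod_def power2_eq_square)
  ultimately have "norm (d - d * cis (pi / 3)) = norm d" by (simp add: norm_mult)
  with d have "d \<noteq> 0 \<Longrightarrow> dist A (A + d) = s \<and> dist (A + d) (A + d * cis (pi / 3)) = s \<and>
      dist (A + d * cis (pi / 3)) A = s \<and> s > 0"
    by (simp add: dist_norm norm_mult)
  with d show "equilateral_triangle s T"
    unfolding equilateral_triangle_def tri_def by blast
qed

section \<open>Packings as finite sets of triangles\<close>

text \<open>
  A set of pairs \<open>(A, d)\<close> in place of an indexed family makes it easy to unite packings
  and to replace members. No triangle is lost by this: equal members of a family would have
  overlapping interiors.
\<close>

definition packing :: "(complex \<times> complex) set \<Rightarrow> complex set \<Rightarrow> bool" where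
  "packing F V \<longleftrightarrow> finite F \<and> (\<forall>(A, d)\<in>F. d \<noteq> 0 \<and> tri A d \<subseteq> V) \<and>
     disjoint_family_on (\<lambda>(A, d). interior (tri A d)) F"

definition side_sum :: "(complex \<times> complex) set \<Rightarrow> real" where
  "side_sum F = (\<Sum>(A, d)\<in>F. norm d)"

lemma packing_iff:
  "packing F V \<longleftrightarrow> finite F \<and> (\<forall>A d. (A, d) \<in> F \<longrightarrow> d \<noteq> 0 \<and> tri A d \<subseteq> V) \<and>
     (\<forall>A d B e. (A, d) \<in> F \<longrightarrow> (B, e) \<in> F \<longrightarrow> (A, d) \<noteq> (B, e) \<longrightarrow>
       interior (tri A d) \<inter> interior (tri B e) = {})"
  unfolding packing_def disjoint_family_on_def by (simp add: Ball_def split_paired_all)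

lemma packing_disjoint:
  assumes "packing F V" "(A, d) \<in> F" "(B, e) \<in> F" "(A, d) \<noteq> (B, e)"
  shows "interior (tri A d) \<inter> interior (tri B e) = {}"
  using assms(1) [unfolded packing_iff, THEN conjunct2, THEN conjunct2, rule_format, OF assms(2-4)] .

lemma packing_member:
  assumes "packing F V" "(A, d) \<in> F"
  shows "d \<noteq> 0" "tri A d \<subseteq> V"
  using assms(1) [unfolded packing_iff, THEN conjunct2, THEN conjunct1, rule_format, OF assms(2)]
  by simp_all

lemma packing_subset:
  assumes "packing F V" "G \<subseteq> F"
  shows "packing G V"
  using assms finite_subset [of G F] disjoint_family_on_mono [of G F]
  unfolding packing_def by blast

lemma packing_interior_subset:
  "packing F V \<Longrightarrow> (A, d) \<in> F \<Longrightarrow> interior (tri A d) \<subseteq> interior V"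
  by (intro interior_mono packing_member)

lemma packing_Un:
  assumes F: "packing F V" and G: "packing G W" and "V \<subseteq> W"
    and disj: "\<And>A d. (A, d) \<in> G \<Longrightarrow> interior (tri A d) \<inter> interior V = {}"
  shows "packing (F \<union> G) W" "card (F \<union> G) = card F + card G"
    "side_sum (F \<union> G) = side_sum F + side_sum G"
proof -
  have sep: "interior (tri A d) \<inter> interior (tri B e) = {}" if "(A, d) \<in> F" "(B, e) \<in> G" for A d B e
    using packing_interior_subset [OF F that(1)] disj [OF that(2)] by blast
  have "F \<inter> G = {}"
  proof (rule ccontr)
    assume "F \<inter> G \<noteq> {}"
    then obtain A d where Ad: "(A, d) \<in> F" "(A, d) \<in> G" by auto
    then have "d \<noteq> 0" using packing_member(1) [OF F] by blast
    then show False using sep [OF Ad] interior_tri_nonempty by simp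
  qed
  moreover have "finite F" "finite G" using F G by (auto simp: packing_def)
  ultimately show "card (F \<union> G) = card F + card G" "side_sum (F \<union> G) = side_sum F + side_sum G"
    by (simp_all add: card_Un_disjoint side_sum_def sum.union_disjoint)
  show "packing (F \<union> G) W"
    unfolding packing_iff
  proof (intro conjI allI impI)
    show "finite (F \<union> G)" using F G by (simp add: packing_def)
  next
    fix A d assume "(A, d) \<in> F \<union> G"
    then show "d \<noteq> 0" "tri A d \<subseteq> W"
      using packing_member [OF F] packing_member [OF G] \<open>V \<subseteq> W\<close> by blast+
  next
    fix A d B e assume pq: "(A, d) \<in> F \<union> G" "(B, e) \<in> F \<union> G" "(A, d) \<noteq> (B, e)"
    from pq(1,2) consider "(A, d) \<in> F" "(B, e) \<in> F" | "(A, d) \<in> G" "(B, e) \<in> G"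
      | "(A, d) \<in> F" "(B, e) \<in> G" | "(A, d) \<in> G" "(B, e) \<in> F" by blast
    then show "interior (tri A d) \<inter> interior (tri B e) = {}"
      using packing_disjoint [OF F _ _ pq(3)] packing_disjoint [OF G _ _ pq(3)]
        sep [of A d B e] sep [of B e A d] by cases (simp_all add: Int_commute)
  qed
qed

lemma packing_scale:
  assumes "packing F (tri 0 L)" "r > 0"
  shows "\<exists>G. packing G (tri 0 (of_real r * L)) \<and> card G = card F \<and> side_sum G = r * side_sum F"
proof -
  define h where "h = (\<lambda>(A :: complex, d :: complex). (of_real r * A, of_real r * d))"
  have inj: "inj_on h X" for X
    using \<open>r > 0\<close> by (auto simp: h_def inj_on_def)
  have img: "tri (of_real r * A) (of_real r * d) = (\<lambda>z. of_real r * z) ` tri A d" for A d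
    using tri_affine [of 0 "of_real r" A d] by simp
  have int: "interior (tri (of_real r * A) (of_real r * d)) = (\<lambda>z. of_real r * z) ` interior (tri A d)" for A d
    using interior_affine_image [of "of_real r" 0 "tri A d"] \<open>r > 0\<close> by (simp add: img)
  have "packing (h ` F) (tri 0 (of_real r * L))"
    unfolding packing_iff
  proof (intro conjI allI impI)
    show "finite (h ` F)" using assms by (simp add: packing_def)
  next
    fix A' d' assume "(A', d') \<in> h ` F"
    then obtain A d where "(A, d) \<in> F" "A' = of_real r * A" "d' = of_real r * d"
      by (auto simp: h_def)
    moreover from this have "d \<noteq> 0" "tri A d \<subseteq> tri 0 L"
      using packing_member [OF assms(1)] by blast+
    ultimately show "d' \<noteq> 0" "tri A' d' \<subseteq> tri 0 (of_real r * L)"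
      using \<open>r > 0\<close> img [of 0 L] by (simp_all add: img image_mono)
  next
    fix A' d' B' e' assume *: "(A', d') \<in> h ` F" "(B', e') \<in> h ` F" "(A', d') \<noteq> (B', e')"
    then obtain A d B e where
      "(A, d) \<in> F" "A' = of_real r * A" "d' = of_real r * d"
      "(B, e) \<in> F" "B' = of_real r * B" "e' = of_real r * e"
      by (auto simp: h_def)
    moreover from this * have "interior (tri A d) \<inter> interior (tri B e) = {}"
      by (intro packing_disjoint [OF assms(1)]) auto
    moreover have "inj (\<lambda>z. of_real r * z :: complex)"
      using \<open>r > 0\<close> by (simp add: inj_on_def)
    ultimately show "interior (tri A' d') \<inter> interior (tri B' e') = {}"
      using image_Int [of "\<lambda>z. of_real r * z" "interior (tri A d)" "interior (tri B e)"]
      by (simp only: int image_empty)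
  qed
  moreover have "side_sum (h ` F) = r * side_sum F"
    using \<open>r > 0\<close>
    unfolding side_sum_def sum.reindex [OF inj] sum_distrib_left
    by (simp add: h_def case_prod_beta norm_mult)
  ultimately show ?thesis using card_image [OF inj, of F] by blast
qed

text \<open>
  A triangle of side \<open>s\<close> contains two triangles of side \<open>s / 2\<close> at the two
  ends of one edge, so the number of triangles grows by one and the side sum stays.
\<close>

lemma packing_split:
  assumes F: "packing F V" and "F \<noteq> {}"
  shows "\<exists>G. packing G V \<and> card G = Suc (card F) \<and> side_sum G = side_sum F"
proof -
  obtain A d where Ad: "(A, d) \<in> F" using \<open>F \<noteq> {}\<close> by auto
  then have d: "d \<noteq> 0" "tri A d \<subseteq> V" using packing_member [OF F] by blast+
  define H where "H = {(A, d / 2), (A + d / 2, d / 2)}"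
  have ne: "A \<noteq> A + d / 2" using d by simp
  have d2: "d / 2 \<noteq> 0" using d by simp
  have "(z - (A + d / 2)) / (d / 2) = 2 *\<^sub>R ((z - A) / d) - 1"
      "(z - A) / (d / 2) = 2 *\<^sub>R ((z - A) / d)" for z
    using d by (simp_all add: scaleR_conv_of_real field_simps)
  then have half: "skew_x ((z - (A + d / 2)) / (d / 2)) = 2 * skew_x ((z - A) / d) - 1"
      "skew_y ((z - (A + d / 2)) / (d / 2)) = 2 * skew_y ((z - A) / d)"
      "skew_x ((z - A) / (d / 2)) = 2 * skew_x ((z - A) / d)"
      "skew_y ((z - A) / (d / 2)) = 2 * skew_y ((z - A) / d)" for z
    by (simp_all only: skew_linear skew_basis diff_0_right)
  have sub: "tri A (d / 2) \<subseteq> tri A d" "tri (A + d / 2) (d / 2) \<subseteq> tri A d"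
    unfolding subset_iff mem_tri [OF d(1)] mem_tri [OF d2] half by auto
  have "interior (tri A (d / 2)) \<inter> interior (tri (A + d / 2) (d / 2)) = {}"
    unfolding disjoint_iff mem_interior_tri [OF d2] half by auto
  then have H: "packing H (tri A d)"
    using d sub by (simp add: packing_def H_def disjoint_family_on_def Int_commute)
  have F': "packing (F - {(A, d)}) V"
    using packing_subset [OF F] by blast
  have disj: "interior (tri B e) \<inter> interior (tri A d) = {}" if "(B, e) \<in> F - {(A, d)}" for B e
    using that by (intro packing_disjoint [OF F _ Ad]) auto
  note U = packing_Un [OF H F' d(2) disj]
  have fin: "finite F" using F by (simp add: packing_def)
  have "card H = 2" using ne by (simp add: H_def)
  then have "card (H \<union> (F - {(A, d)})) = Suc (card F)"
    using U(2) card_Suc_Diff1 [OF fin Ad] by simp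
  moreover have "side_sum H = norm d" using ne by (simp add: side_sum_def H_def norm_divide)
  then have "side_sum (H \<union> (F - {(A, d)})) = side_sum F"
    using U(3) sum.remove [OF fin Ad, of "\<lambda>(A, d). norm d"] by (simp add: side_sum_def)
  ultimately show ?thesis using U(1) by blast
qed

lemma packing_pad:
  assumes "packing F V" "F \<noteq> {}" "card F \<le> n"
  shows "\<exists>G. packing G V \<and> card G = n \<and> side_sum G = side_sum F"
  using \<open>card F \<le> n\<close>
proof (induction n rule: dec_induct)
  case base
  then show ?case using assms by blast
next
  case (step n)
  then obtain G where G: "packing G V" "card G = n" "side_sum G = side_sum F" by blast
  moreover have "card F > 0" using assms by (simp add: packing_def card_gt_0_iff)
  then have "G \<noteq> {}" using G step by auto
  ultimately show ?case using packing_split [of G V] by auto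
qed

section \<open>Enlarging a packing by cells of the triangular grid\<close>

lemma mem_tri_of_nat:
  "z \<in> tri 0 (of_nat n) \<longleftrightarrow> 0 \<le> skew_x z \<and> 0 \<le> skew_y z \<and> skew_x z + skew_y z \<le> real n"
proof (cases "n = 0")
  case True
  have "z = 0" if "skew_x z = 0" "skew_y z = 0" using that by (intro skew_eqI) simp_all
  with True show ?thesis by force
next
  case False
  have "skew_x (z / of_nat n) = skew_x z / real n" "skew_y (z / of_nat n) = skew_y z / real n"
    using skew_linear(11,12) [of z "real n"] by simp_all
  with False show ?thesis
    by (simp add: mem_tri add_divide_distrib [symmetric] zero_le_divide_iff)
qed

lemma interior_tri_of_nat:
  assumes "z \<in> interior (tri 0 (of_nat n))"
  shows "skew_x z + skew_y z < real n"
proof (cases "n = 0")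
  case False
  have "skew_x (z / of_nat n) = skew_x z / real n" "skew_y (z / of_nat n) = skew_y z / real n"
    using skew_linear(11,12) [of z "real n"] by simp_all
  with False assms show ?thesis
    by (simp add: mem_interior_tri add_divide_distrib [symmetric])
qed (use assms in simp)

text \<open>
  The strip between the triangles of side \<open>m\<close> and \<open>m + 1\<close> is the part where
  \<open>x + y\<close> lies between \<open>m\<close> and \<open>m + 1\<close>. It consists of
  \<open>m + 1\<close> cells pointing up and, between consecutive ones of these, \<open>m\<close> cells
  pointing down, which have edge vector \<open>- 1\<close>. Two cells of the same kind are
  separated by a line where \<open>x\<close> is constant, two cells of different kinds by such a line or
  by one where \<open>y\<close> is constant.
\<close>

lemma strip_packing:
  "\<exists>S. packing S (tri 0 (of_nat (Suc m))) \<and> card S = 2 * m + 1 \<and> side_sum S = 2 * real m + 1 \<and>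
     (\<forall>(A, d)\<in>S. interior (tri A d) \<inter> interior (tri 0 (of_nat m)) = {})"
proof -
  define corner where "corner = (\<lambda>i j. of_nat i + of_nat j * cis (pi / 3))"
  define up where "up = (\<lambda>i. (corner i (m - i), 1 :: complex))"
  define down where "down = (\<lambda>i. (corner (Suc i) (m - i), - 1 :: complex))"
  have corner [simp]: "skew_x (corner i j) = real i" "skew_y (corner i j) = real j" for i j
    using skew_linear(7,8) [of "real j"] by (simp_all add: corner_def)
  have in_up: "z \<in> interior (tri (fst (up i)) (snd (up i))) \<longleftrightarrow>
      real i < skew_x z \<and> real m - real i < skew_y z \<and> skew_x z + skew_y z < real (Suc m)"
    if "i \<le> m" for z i
    using that by (auto simp: up_def mem_interior_tri of_nat_diff)
  have in_down: "z \<in> interior (tri (fst (down i)) (snd (down i))) \<longleftrightarrow>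
      skew_x z < real (Suc i) \<and> skew_y z < real m - real i \<and> real m < skew_x z + skew_y z"
    if "i < m" for z i
    using that by (auto simp: down_def mem_interior_tri of_nat_diff)
  define S where "S = up ` {..m} \<union> down ` {..<m}"
  have S_cases: "(\<exists>i\<le>m. p = up i) \<or> (\<exists>i<m. p = down i)" if "p \<in> S" for p
    using that by (auto simp: S_def)
  have inj: "inj_on up {..m}" "inj_on down {..<m}"
    using corner by (auto simp: inj_on_def up_def down_def dest!: arg_cong [where f = skew_x])
  have ud: "up ` {..m} \<inter> down ` {..<m} = {}" by (auto simp: up_def down_def)
  have up_up: "interior (tri (fst (up i)) (snd (up i))) \<inter> interior (tri (fst (up j)) (snd (up j))) = {}"
    if "i < j" "j \<le> m" for i j
  proof -
    have "real i + 1 \<le> real j" using that by simp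
    then show ?thesis using that by (auto simp: in_up)
  qed
  have down_down: "interior (tri (fst (down i)) (snd (down i))) \<inter> interior (tri (fst (down j)) (snd (down j))) = {}"
    if "i < j" "j < m" for i j
  proof -
    have "real i + 1 \<le> real j" using that by simp
    then show ?thesis using that by (auto simp: in_down)
  qed
  have up_down: "interior (tri (fst (up i)) (snd (up i))) \<inter> interior (tri (fst (down j)) (snd (down j))) = {}"
    if "i \<le> m" "j < m" for i j
  proof -
    have "i \<le> j \<or> real j + 1 \<le> real i" by linarith
    then show ?thesis using that by (auto simp: in_up in_down)
  qed
  have "packing S (tri 0 (of_nat (Suc m)))"
    unfolding packing_iff
  proof (intro conjI allI impI)
    show "finite S" by (simp add: S_def)
  next
    fix A d assume "(A, d) \<in> S"
    moreover have "tri (corner i (m - i)) 1 \<subseteq> tri 0 (of_nat (Suc m))" if "i \<le> m" for i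
        using that unfolding tri_subset_iff [OF convex_tri] mem_tri_of_nat
        by (auto simp: of_nat_diff)
    moreover have "tri (corner (Suc i) (m - i)) (- 1) \<subseteq> tri 0 (of_nat (Suc m))" if "i < m" for i
        using that unfolding tri_subset_iff [OF convex_tri] mem_tri_of_nat
        by (auto simp: of_nat_diff)
    ultimately show "d \<noteq> 0" "tri A d \<subseteq> tri 0 (of_nat (Suc m))"
      by (auto simp: S_def up_def down_def)
  next
    fix A d B e assume pq: "(A, d) \<in> S" "(B, e) \<in> S" "(A, d) \<noteq> (B, e)"
    have "interior (tri (fst p) (snd p)) \<inter> interior (tri (fst q) (snd q)) = {}"
      if "p \<in> S" "q \<in> S" "p \<noteq> q" for p q
      using S_cases [OF \<open>p \<in> S\<close>] S_cases [OF \<open>q \<in> S\<close>]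
    proof (elim disjE exE conjE)
      fix i j assume "i \<le> m" "p = up i" "j \<le> m" "q = up j"
      then show ?thesis using \<open>p \<noteq> q\<close> up_up [of i j] up_up [of j i]
        by (cases i j rule: linorder_cases) (simp_all add: Int_commute)
    next
      fix i j assume "i < m" "p = down i" "j < m" "q = down j"
      then show ?thesis using \<open>p \<noteq> q\<close> down_down [of i j] down_down [of j i]
        by (cases i j rule: linorder_cases) (simp_all add: Int_commute)
    next
      fix i j assume "i \<le> m" "p = up i" "j < m" "q = down j"
      then show ?thesis using up_down [of i j] by simp
    next
      fix i j assume "i < m" "p = down i" "j \<le> m" "q = up j"
      then show ?thesis using up_down [of j i] by (simp add: Int_commute)
    qed
    from this [OF pq] show "interior (tri A d) \<inter> interior (tri B e) = {}" by simp
  qed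
  moreover have "card S = 2 * m + 1"
    using inj ud by (simp add: S_def card_Un_disjoint card_image)
  moreover have "norm (snd p) = 1" if "p \<in> S" for p
    using S_cases [OF that] by (auto simp: up_def down_def)
  then have "side_sum S = real (card S)"
    by (simp add: side_sum_def case_prod_beta)
  moreover have "interior (tri A d) \<inter> interior (tri 0 (of_nat m)) = {}" if Ad: "(A, d) \<in> S" for A d
  proof -
    have "real m < skew_x z + skew_y z" if z: "z \<in> interior (tri A d)" for z
    proof -
      consider i where "i \<le> m" "(A, d) = up i" | i where "i < m" "(A, d) = down i"
        using S_cases [OF Ad] by blast
      then show ?thesis
      proof cases
        case 1
        then show ?thesis using in_up [OF 1(1), of z] z by (simp add: 1(2) [symmetric])
      next
        case 2
        then show ?thesis using in_down [OF 2(1), of z] z by (simp add: 2(2) [symmetric])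
      qed
    qed
    then show ?thesis using interior_tri_of_nat by fastforce
  qed
  ultimately show ?thesis by (intro exI [of _ S]) auto
qed

lemma extend_by_strip:
  assumes F: "packing F (tri 0 (of_nat m))"
  shows "\<exists>G. packing G (tri 0 (of_nat (Suc m))) \<and> card G = card F + (2 * m + 1) \<and>
    side_sum G = side_sum F + (2 * real m + 1)"
proof -
  obtain S where S: "packing S (tri 0 (of_nat (Suc m)))" "card S = 2 * m + 1"
      "side_sum S = 2 * real m + 1"
      "\<And>A d. (A, d) \<in> S \<Longrightarrow> interior (tri A d) \<inter> interior (tri 0 (of_nat m)) = {}"
    using strip_packing [of m] by blast
  have "tri 0 (of_nat m) \<subseteq> tri 0 (of_nat (Suc m))"
    unfolding subset_iff mem_tri_of_nat by auto
  from packing_Un [OF F S(1) this S(4)] S(2,3) show ?thesis by auto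
qed

lemma enlarge_packing:
  assumes "packing F (tri 0 (of_nat k))" "k \<le> m"
  shows "\<exists>G. packing G (tri 0 (of_nat m)) \<and> card G + k\<^sup>2 = card F + m\<^sup>2 \<and>
    side_sum G + (real k)\<^sup>2 = side_sum F + (real m)\<^sup>2"
  using \<open>k \<le> m\<close>
proof (induction m rule: dec_induct)
  case base
  then show ?case using assms by blast
next
  case (step m)
  then obtain G where G: "packing G (tri 0 (of_nat m))" "card G + k\<^sup>2 = card F + m\<^sup>2"
      "side_sum G + (real k)\<^sup>2 = side_sum F + (real m)\<^sup>2" by blast
  from extend_by_strip [OF G(1)] obtain H where
    "packing H (tri 0 (of_nat (Suc m)))" "card H = card G + (2 * m + 1)"
    "side_sum H = side_sum G + (2 * real m + 1)" by blast
  with G show ?case by (intro exI [of _ H]) (auto simp: power2_eq_square algebra_simps)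
qed

section \<open>The maximum is attained\<close>

lemma packing_image:
  assumes "finite I"
    and "\<And>i. i \<in> I \<Longrightarrow> d i \<noteq> 0 \<and> tri (A i) (d i) \<subseteq> V"
    and disj: "\<And>i j. i \<in> I \<Longrightarrow> j \<in> I \<Longrightarrow> i \<noteq> j \<Longrightarrow>
      interior (tri (A i) (d i)) \<inter> interior (tri (A j) (d j)) = {}"
  shows "packing ((\<lambda>i. (A i, d i)) ` I) V" "card ((\<lambda>i. (A i, d i)) ` I) = card I"
    "side_sum ((\<lambda>i. (A i, d i)) ` I) = (\<Sum>i\<in>I. norm (d i))"
proof -
  have inj: "inj_on (\<lambda>i. (A i, d i)) I"
  proof (rule inj_onI, rule ccontr)
    fix i j assume "i \<in> I" "j \<in> I" "(A i, d i) = (A j, d j)" "i \<noteq> j"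
    with disj [of i j] interior_tri_nonempty [of "d i" "A i"] assms(2) [of i] show False by simp
  qed
  then show "card ((\<lambda>i. (A i, d i)) ` I) = card I"
    "side_sum ((\<lambda>i. (A i, d i)) ` I) = (\<Sum>i\<in>I. norm (d i))"
    by (simp_all add: card_image side_sum_def sum.reindex)
  show "packing ((\<lambda>i. (A i, d i)) ` I) V"
    using assms(1,2) unfolding packing_def disjoint_family_on_def by (auto dest: disj)
qed

lemma packing_enumerate:
  assumes "packing F V" "card F = n"
  obtains A d where "\<And>i. i < n \<Longrightarrow> d i \<noteq> 0 \<and> tri (A i) (d i) \<subseteq> V"
    "\<And>i j. i < n \<Longrightarrow> j < n \<Longrightarrow> i \<noteq> j \<Longrightarrow>
      interior (tri (A i) (d i)) \<inter> interior (tri (A j) (d j)) = {}"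
    "side_sum F = (\<Sum>i<n. norm (d i))"
proof -
  have "finite F" using assms by (simp add: packing_def)
  then obtain h where h: "bij_betw h {..<n} F"
    using ex_bij_betw_nat_finite [of F] assms(2) by (auto simp: atLeast0LessThan)
  show thesis
  proof (rule that [of "\<lambda>i. snd (h i)" "\<lambda>i. fst (h i)"])
    fix i assume "i < n"
    then have "(fst (h i), snd (h i)) \<in> F" using h by (auto simp: bij_betw_def)
    then show "snd (h i) \<noteq> 0 \<and> tri (fst (h i)) (snd (h i)) \<subseteq> V"
      using packing_member [OF assms(1)] by blast
  next
    fix i j assume "i < n" "j < n" "i \<noteq> j"
    then have "(fst (h i), snd (h i)) \<in> F" "(fst (h j), snd (h j)) \<in> F" "h i \<noteq> h j"
      using h by (auto simp: bij_betw_def inj_on_def)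
    then show "interior (tri (fst (h i)) (snd (h i))) \<inter> interior (tri (fst (h j)) (snd (h j))) = {}"
      by (intro packing_disjoint [OF assms(1)]) (auto simp: prod_eq_iff)
  next
    show "side_sum F = (\<Sum>i<n. norm (snd (h i)))"
      unfolding side_sum_def sum.reindex_bij_betw [OF h, symmetric] by (simp add: case_prod_beta)
  qed
qed

lemma triangle_packing_iff_packing:
  "(\<exists>a T. triangle_packing n a T \<and> s = (\<Sum>i<n. a i)) \<longleftrightarrow>
   (\<exists>F. packing F (tri 0 1) \<and> card F = n \<and> s = side_sum F)"
proof
  assume "\<exists>a T. triangle_packing n a T \<and> s = (\<Sum>i<n. a i)"
  then obtain a T where p: "triangle_packing n a T" and s: "s = (\<Sum>i<n. a i)" by blast
  then have "\<forall>i. \<exists>A d. i < n \<longrightarrow> d \<noteq> 0 \<and> a i = norm d \<and> T i = tri A d"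
    unfolding triangle_packing_def equilateral_triangle_iff_tri by blast
  then obtain A d where Ad: "\<And>i. i < n \<Longrightarrow> d i \<noteq> 0 \<and> a i = norm (d i) \<and> T i = tri (A i) (d i)"
    by metis
  have 1: "d i \<noteq> 0 \<and> tri (A i) (d i) \<subseteq> tri 0 1" if "i \<in> {..<n}" for i
  proof -
    have "T i \<subseteq> tri 0 1" using p that by (simp add: triangle_packing_def unit_triangle_eq)
    with Ad [of i] that show ?thesis by simp
  qed
  have 2: "interior (tri (A i) (d i)) \<inter> interior (tri (A j) (d j)) = {}"
    if "i \<in> {..<n}" "j \<in> {..<n}" "i \<noteq> j" for i j
  proof -
    have "interior (T i) \<inter> interior (T j) = {}"
      using p that by (simp add: triangle_packing_def disjoint_family_on_def)
    with Ad [of i] Ad [of j] that show ?thesis by simp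
  qed
  from packing_image [OF finite_lessThan 1 2] s Ad
  show "\<exists>F. packing F (tri 0 1) \<and> card F = n \<and> s = side_sum F"
    by (intro exI [of _ "(\<lambda>i. (A i, d i)) ` {..<n}"]) simp
next
  assume "\<exists>F. packing F (tri 0 1) \<and> card F = n \<and> s = side_sum F"
  then obtain F where F: "packing F (tri 0 1)" "card F = n" "s = side_sum F" by blast
  from packing_enumerate [OF F(1,2)] obtain A d where
    "\<And>i. i < n \<Longrightarrow> d i \<noteq> 0 \<and> tri (A i) (d i) \<subseteq> tri 0 1"
    "\<And>i j. i < n \<Longrightarrow> j < n \<Longrightarrow> i \<noteq> j \<Longrightarrow>
      interior (tri (A i) (d i)) \<inter> interior (tri (A j) (d j)) = {}"
    "side_sum F = (\<Sum>i<n. norm (d i))" by metis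
  with F(3) show "\<exists>a T. triangle_packing n a T \<and> s = (\<Sum>i<n. a i)"
    by (intro exI [of _ "\<lambda>i. norm (d i)"] exI [of _ "\<lambda>i. tri (A i) (d i)"])
       (auto simp: triangle_packing_def equilateral_triangle_iff_tri unit_triangle_eq
          disjoint_family_on_def)
qed

lemma unit_packing: "packing {(0, 1)} (tri 0 1)"
  by (simp add: packing_def disjoint_family_on_def)

lemma unit_packing_pad:
  assumes "n \<ge> 1"
  shows "\<exists>F. packing F (tri 0 1) \<and> card F = n \<and> side_sum F = 1"
  using packing_pad [OF unit_packing, of n] assms by (auto simp: side_sum_def)

text \<open>
  Tychonoff's theorem for equal factors, in terms of the topology on the function type.
\<close>

lemma compact_product:
  assumes "compact (K :: 'a :: topological_space set)"
  shows "compact {g :: 'i \<Rightarrow> 'a. \<forall>i. g i \<in> K}"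
proof -
  have "compactin (product_topology (\<lambda>i :: 'i. euclidean) UNIV) (PiE UNIV (\<lambda>i :: 'i. K))"
    using assms by (simp add: compactin_PiE)
  moreover have "PiE UNIV (\<lambda>i :: 'i. K) = {g. \<forall>i. g i \<in> K}"
    by (auto simp: PiE_UNIV_domain)
  ultimately show ?thesis by (simp add: euclidean_product_topology)
qed

text \<open>
  Two interiors that share a point \<open>z\<close> still share it after a small change of the
  triangles.
\<close>

lemma closed_disjoint_interiors:
  fixes f g :: "'a :: topological_space \<Rightarrow> complex \<times> complex"
  assumes [continuous_intros]: "continuous_on UNIV f" "continuous_on UNIV g"
  shows "closed {x. interior (tri (fst (f x)) (snd (f x))) \<inter> interior (tri (fst (g x)) (snd (g x))) = {}}"
proof -
  have "open {x. z \<in> interior (tri (fst (h x)) (snd (h x)))}"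
    if [continuous_intros]: "continuous_on UNIV h" for z and h :: "'a \<Rightarrow> complex \<times> complex"
    unfolding mem_interior_tri_polynomial
    by (intro open_Collect_conj open_Collect_less continuous_intros)
  then have "open {x. \<exists>z. z \<in> interior (tri (fst (f x)) (snd (f x))) \<and>
      z \<in> interior (tri (fst (g x)) (snd (g x)))}"
    by (intro open_Collect_ex open_Collect_conj) (simp_all add: assms)
  moreover have "{x. interior (tri (fst (f x)) (snd (f x))) \<inter> interior (tri (fst (g x)) (snd (g x))) = {}}
     = - {x. \<exists>z. z \<in> interior (tri (fst (f x)) (snd (f x))) \<and>
      z \<in> interior (tri (fst (g x)) (snd (g x)))}"
    by auto
  ultimately show ?thesis by (simp only: closed_Compl)
qed

text \<open>
  The side sum is continuous on the compact space of families of \<open>n\<close> triangles in the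
  unit triangle, degenerate ones included. A maximiser has at least one nondegenerate
  member, because the unit triangle alone already gives the side sum \<open>1\<close>; its nondegenerate
  members can then be split in two, with the side sum kept, until there are \<open>n\<close> of
  them.
\<close>

lemma optimal_packing_exists:
  assumes "n \<ge> 1"
  shows "\<exists>F. packing F (tri 0 1) \<and> card F = n \<and>
    (\<forall>G. packing G (tri 0 1) \<and> card G = n \<longrightarrow> side_sum G \<le> side_sum F)"
proof -
  define U where "U = tri 0 1"
  \<comment> \<open>Edge vectors of triangles in \<open>U\<close> lie in the compact set \<open>D\<close> of differences.\<close>
  define D where "D = {x - y |x y. x \<in> U \<and> y \<in> U}"
  define inside where "inside = (\<lambda>p :: complex \<times> complex. fst p + snd p \<in> U \<and> fst p + snd p * cis (pi / 3) \<in> U)"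
  define apart where "apart = (\<lambda>p q :: complex \<times> complex.
    interior (tri (fst p) (snd p)) \<inter> interior (tri (fst q) (snd q)) = {})"
  define P where "P = {g. \<forall>i :: nat. g i \<in> U \<times> D} \<inter> (\<Inter>i\<in>{..<n}. {g. inside (g i)}) \<inter>
    (\<Inter>i\<in>{..<n}. \<Inter>j\<in>{..<n} - {i}. {g. apart (g i) (g j)})"
  have U: "compact U" "convex U" "0 \<in> U" by (simp_all add: U_def) (simp add: tri_def hull_inc)
  have "0 \<in> D" using U(3) by (force simp: D_def)
  have coord [continuous_intros]: "continuous_on UNIV (\<lambda>g :: nat \<Rightarrow> complex \<times> complex. g i)" for i
    by (rule continuous_on_product_coordinates)
  have "compact (U \<times> D)"
    unfolding D_def by (intro compact_Times compact_differences U)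
  moreover have "closed {g :: nat \<Rightarrow> complex \<times> complex. inside (g i)}" for i
    unfolding inside_def
    by (intro closed_Collect_conj closed_vimage [unfolded vimage_def] continuous_intros
        compact_imp_closed U)
  moreover have "closed {g :: nat \<Rightarrow> complex \<times> complex. apart (g i) (g j)}" for i j
    unfolding apart_def by (intro closed_disjoint_interiors coord)
  ultimately have "compact P"
    unfolding P_def by (intro compact_Int_closed compact_product closed_INT ballI)
  define \<sigma> where "\<sigma> = (\<lambda>g :: nat \<Rightarrow> complex \<times> complex. \<Sum>i<n. norm (snd (g i)))"
  have realised: "\<exists>g\<in>P. \<sigma> g = side_sum G" if G: "packing G U" "card G = n" for G
  proof -
    from packing_enumerate [OF G] obtain A d where
      in_U: "\<And>i. i < n \<Longrightarrow> d i \<noteq> 0 \<and> tri (A i) (d i) \<subseteq> U" and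
      disj: "\<And>i j. i < n \<Longrightarrow> j < n \<Longrightarrow> i \<noteq> j \<Longrightarrow>
        interior (tri (A i) (d i)) \<inter> interior (tri (A j) (d j)) = {}" and
      sum: "side_sum G = (\<Sum>i<n. norm (d i))" by metis
    define g where "g = (\<lambda>i. if i < n then (A i, d i) else (0, 0))"
    have "A i \<in> U" "inside (A i, d i)" "d i \<in> D" if "i < n" for i
    proof -
      have *: "A i \<in> U" "A i + d i \<in> U" "A i + d i * cis (pi / 3) \<in> U"
        using in_U [OF that] tri_subset_iff [OF U(2)] by blast+
      then show "A i \<in> U" "inside (A i, d i)" by (simp_all add: inside_def)
      show "d i \<in> D" unfolding D_def using * by (intro CollectI exI [of _ "A i + d i"] exI [of _ "A i"]) simp
    qed
    then have "g \<in> P"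
      using disj U(3) \<open>0 \<in> D\<close> by (auto simp: P_def g_def apart_def)
    moreover have "\<sigma> g = side_sum G" by (simp add: \<sigma>_def g_def sum)
    ultimately show ?thesis by blast
  qed
  obtain G1 where G1: "packing G1 U" "card G1 = n" "side_sum G1 = 1"
    using unit_packing_pad [OF assms] unfolding U_def by blast
  have "continuous_on P \<sigma>"
    unfolding \<sigma>_def by (rule continuous_on_subset [OF _ subset_UNIV]) (intro continuous_intros)
  with \<open>compact P\<close> realised [OF G1(1,2)] obtain g where
    "g \<in> P" and max: "\<And>g'. g' \<in> P \<Longrightarrow> \<sigma> g' \<le> \<sigma> g"
    using continuous_attains_sup [of P \<sigma>] by blast
  define I where "I = {i. i < n \<and> snd (g i) \<noteq> 0}"
  have I: "finite I" "I \<subseteq> {..<n}" by (auto simp: I_def)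
  have sum_I: "\<sigma> g = (\<Sum>i\<in>I. norm (snd (g i)))"
    unfolding \<sigma>_def by (rule sum.mono_neutral_right) (auto simp: I_def)
  define F where "F = (\<lambda>i. (fst (g i), snd (g i))) ` I"
  have 1: "snd (g i) \<noteq> 0 \<and> tri (fst (g i)) (snd (g i)) \<subseteq> U" if "i \<in> I" for i
  proof -
    have "i < n" using that by (simp add: I_def)
    then have "g i \<in> U \<times> D" "inside (g i)" using \<open>g \<in> P\<close> by (auto simp: P_def)
    then show ?thesis
      using that unfolding tri_subset_iff [OF U(2)] by (auto simp: inside_def I_def)
  qed
  have 2: "interior (tri (fst (g i)) (snd (g i))) \<inter> interior (tri (fst (g j)) (snd (g j))) = {}"
    if "i \<in> I" "j \<in> I" "i \<noteq> j" for i j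
  proof -
    have "i < n" "j < n" using that by (simp_all add: I_def)
    then have "apart (g i) (g j)" using \<open>g \<in> P\<close> \<open>i \<noteq> j\<close> by (simp add: P_def)
    then show ?thesis by (simp add: apart_def)
  qed
  have F: "packing F U" "card F = card I" "side_sum F = \<sigma> g"
    unfolding F_def sum_I by (rule packing_image [OF I(1) 1 2]; assumption)+
  have "side_sum F \<ge> 1" using realised [OF G1(1,2)] G1(3) max F(3) by metis
  then have "F \<noteq> {}" by (auto simp: side_sum_def)
  moreover have "card F \<le> n" using F(2) card_mono [OF _ I(2)] by simp
  ultimately obtain F' where "packing F' U" "card F' = n" "side_sum F' = side_sum F"
    using packing_pad [OF F(1)] by blast
  moreover have "side_sum G \<le> side_sum F'" if G: "packing G U" "card G = n" for G
  proof -
    obtain g' where "g' \<in> P" "\<sigma> g' = side_sum G" using realised [OF G] by blast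
    then show ?thesis using max [of g'] F(3) \<open>side_sum F' = side_sum F\<close> by simp
  qed
  ultimately show ?thesis unfolding U_def by blast
qed

lemma
  assumes "n \<ge> 1"
  shows max_side_sum_attained: "\<exists>F. packing F (tri 0 1) \<and> card F = n \<and> side_sum F = max_side_sum n"
    and side_sum_le_max_side_sum: "packing G (tri 0 1) \<Longrightarrow> card G = n \<Longrightarrow> side_sum G \<le> max_side_sum n"
proof -
  obtain F where F: "packing F (tri 0 1)" "card F = n"
    "\<And>G. packing G (tri 0 1) \<Longrightarrow> card G = n \<Longrightarrow> side_sum G \<le> side_sum F"
    using optimal_packing_exists [OF assms] by blast
  have "max_side_sum n = side_sum F"
    unfolding max_side_sum_def triangle_packing_iff_packing
    by (rule Greatest_equality) (use F in blast)+
  with F show "\<exists>F. packing F (tri 0 1) \<and> card F = n \<and> side_sum F = max_side_sum n"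
    "packing G (tri 0 1) \<Longrightarrow> card G = n \<Longrightarrow> side_sum G \<le> max_side_sum n"
    by metis+
qed

section \<open>Comparison with the harmonic series\<close>

text \<open>
  Starting from an optimal packing of \<open>k\<^sup>2 + 1\<close> triangles, scaled to side
  \<open>k\<close>, the strips up to side \<open>m\<close> contribute
  \<open>m\<^sup>2 - k\<^sup>2\<close> unit cells. This leaves the side sum in excess of
  \<open>m\<^sup>2\<close> at \<open>k * excess k\<close>, while the number of triangles becomes
  \<open>m\<^sup>2 + 1\<close>.
\<close>

lemma excess_mult_mono:
  assumes "1 \<le> k" "k \<le> m"
  shows "real k * excess k \<le> real m * excess m"
proof -
  have pos: "real k > 0" "1 / real m > 0" and "m > 0" using assms by simp_all
  obtain F where F: "packing F (tri 0 1)" "card F = k\<^sup>2 + 1" "side_sum F = max_side_sum (k\<^sup>2 + 1)"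
    using max_side_sum_attained [of "k\<^sup>2 + 1"] by (metis le_add2)
  have "of_real (real k) * 1 = (of_nat k :: complex)" by simp
  with packing_scale [OF F(1) pos(1)] obtain G where
    G: "packing G (tri 0 (of_nat k))" "card G = card F" "side_sum G = real k * side_sum F"
    by metis
  from enlarge_packing [OF G(1) assms(2)] obtain H where
    H: "packing H (tri 0 (of_nat m))" "card H + k\<^sup>2 = card G + m\<^sup>2"
      "side_sum H + (real k)\<^sup>2 = side_sum G + (real m)\<^sup>2"
    by metis
  have "of_real (1 / real m) * of_nat m = (1 :: complex)" using \<open>m > 0\<close> by simp
  with packing_scale [OF H(1) pos(2)] obtain J where
    J: "packing J (tri 0 1)" "card J = card H" "side_sum J = 1 / real m * side_sum H"
    by metis
  have "card J = m\<^sup>2 + 1" using F(2) G(2) H(2) J(2) by simp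
  with J(1) have "side_sum J \<le> real m + excess m"
    using side_sum_le_max_side_sum [of "m\<^sup>2 + 1" J] by (simp add: excess_def)
  moreover have "side_sum H = (real m)\<^sup>2 + real k * excess k"
    using F(3) G(3) H(3) by (simp add: excess_def power2_eq_square algebra_simps)
  ultimately show ?thesis
    using J(3) \<open>m > 0\<close> by (simp add: field_simps power2_eq_square)
qed

lemma excess_nonneg:
  assumes "k \<ge> 1"
  shows "excess k \<ge> 0"
proof -
  obtain F where "packing F (tri 0 1)" "card F = 1\<^sup>2 + 1" "side_sum F = 1"
    using unit_packing_pad [of "1\<^sup>2 + 1"] by (metis le_add2)
  then have "excess 1 \<ge> 0"
    using side_sum_le_max_side_sum [of "1\<^sup>2 + 1" F] by (simp add: excess_def)
  then have "0 \<le> real k * excess k"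
    using excess_mult_mono [of 1 k] assms by simp
  with assms show ?thesis by (simp add: zero_le_mult_iff)
qed

theorem theorem2:
  "(\<forall>k::nat. k \<ge> 1 \<longrightarrow> max_side_sum (k\<^sup>2 + 1) = real k) \<longleftrightarrow> summable (\<lambda>k. excess (Suc k))"
proof
  assume "\<forall>k::nat. k \<ge> 1 \<longrightarrow> max_side_sum (k\<^sup>2 + 1) = real k"
  then have "excess (Suc k) = 0" for k
    unfolding excess_def by (metis One_nat_def Suc_le_mono diff_self le0)
  then show "summable (\<lambda>k. excess (Suc k))" by simp
next
  assume summable: "summable (\<lambda>k. excess (Suc k))"
  show "\<forall>k::nat. k \<ge> 1 \<longrightarrow> max_side_sum (k\<^sup>2 + 1) = real k"
  proof (intro allI impI, rule ccontr)
    fix k :: nat assume k: "k \<ge> 1" and "max_side_sum (k\<^sup>2 + 1) \<noteq> real k"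
    then have "excess k > 0" using excess_nonneg [OF k] by (simp add: excess_def)
    define c where "c = real k * excess k"
    have "c > 0" using k \<open>excess k > 0\<close> by (simp add: c_def)
    have "norm (c * inverse (real (Suc m))) \<le> excess (Suc m)" if "m \<ge> k" for m
    proof -
      have "c \<le> real (Suc m) * excess (Suc m)"
        unfolding c_def using k that by (intro excess_mult_mono) simp_all
      then show ?thesis using \<open>c > 0\<close> by (simp add: field_simps)
    qed
    then have "summable (\<lambda>m. c * inverse (real (Suc m)))"
      by (intro summable_comparison_test' [OF summable])
    then have "summable (\<lambda>m. inverse (real (Suc m)))"
      using \<open>c > 0\<close> by (simp only: summable_cmult_iff) simp
    then show False
      using summable_Suc_iff [of "\<lambda>m. inverse (real m)"] not_summable_harmonic [where 'a = real]
      by simp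
  qed
qed

end
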